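(* Let $a:\mathbb{R}\to(-1,1)$ be a smooth odd surjection with $a'(\xi)>0$ for all $\xi$, and let $w(\xi)=\dfrac{a'(\xi)}{\pi\sqrt{1-a(\xi)^2}}$. Then for every $z\in\mathbb{C}$ with $\Re(z)>0$ and $z\notin[-1,1]$, \[I_a(z)=\int_0^\infty\frac{w(\xi)\,a(\xi)}{z^2-a(\xi)^2}\,d\xi=\frac{\arcsin(1/z)}{\pi\sqrt{z^2-1}};\] in particular the value is independent of the choice of $a$.
   Context: Principal branches of $\arcsin$ and of the square root are used. *)

theory Defs
  imports "HOL-Analysis.Analysis"
begin

definition smooth :: "(real \<Rightarrow> real) \<Rightarrow> bool" where
  "smooth f \<longleftrightarrow> (\<forall>n x. ((deriv ^^ n) f) differentiable (at x))"

definition admissible :: "(real \<Rightarrow> real) \<Rightarrow> bool" where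
  "admissible a \<longleftrightarrow>
     smooth a \<and> (\<forall>\<xi>. a (- \<xi>) = - a \<xi>) \<and> range a = {-1<..<1} \<and> (\<forall>\<xi>. deriv a \<xi> > 0)"

definition weight :: "(real \<Rightarrow> real) \<Rightarrow> real \<Rightarrow> real" where
  "weight a \<xi> = deriv a \<xi> / (pi * sqrt (1 - (a \<xi>)\<^sup>2))"

definition I_integrand :: "(real \<Rightarrow> real) \<Rightarrow> complex \<Rightarrow> real \<Rightarrow> complex" where
  "I_integrand a z \<xi> =
     complex_of_real (weight a \<xi> * a \<xi>) / (z\<^sup>2 - (complex_of_real (a \<xi>))\<^sup>2)"

definition I_int :: "(real \<Rightarrow> real) \<Rightarrow> complex \<Rightarrow> complex" where
  "I_int a z = (LINT \<xi>:{0..}|lborel. I_integrand a z \<xi>)"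

end

theory Submission
  imports Defs
begin

text \<open>
  The function \<open>u = sqrt (1 - a\<^sup>2)\<close> decreases from \<open>1\<close> to \<open>0\<close> on the half line, and
  \<open>u' = - a a' / u\<close> while \<open>z\<^sup>2 - a\<^sup>2 = s\<^sup>2 + u\<^sup>2\<close> with \<open>s = sqrt (z\<^sup>2 - 1)\<close>. Hence
  \<open>- Arctan (u / s) / (\<pi> s)\<close> is an antiderivative of the integrand, and the integral equals
  \<open>Arctan (1 / s) / (\<pi> s)\<close>. The numbers \<open>sin (Arctan (1 / s))\<close> and \<open>1 / z\<close> have the same square,
  and both have positive real part, so \<open>Arctan (1 / s) = Arcsin (1 / z)\<close>.
\<close>

section \<open>Complex preliminaries: square root, arctangent and arcsine in the right half
  plane\<close>

lemma power2_neq_of_real: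
  assumes "Re z > 0" "z \<notin> complex_of_real ` {-1..1}" "r \<le> 1"
  shows "z\<^sup>2 \<noteq> of_real r"
proof
  assume eq: "z\<^sup>2 = of_real r"
  \<comment> \<open>The imaginary part of the square is twice \<open>Re z * Im z\<close>, so
    \<open>Re z > 0\<close> forces \<open>z\<close> to be real.\<close>
  from arg_cong[OF eq, of Im] have "Im z = 0"
    using assms(1) by (simp add: power2_eq_square)
  then have zr: "z = of_real (Re z)"
    by (simp add: complex_eq_iff)
  from arg_cong[OF eq, of Re] \<open>Im z = 0\<close> have "(Re z)\<^sup>2 \<le> 1"
    using assms(3) by (simp add: power2_eq_square)
  then have "Re z \<in> {-1..1}"
    by (simp add: abs_square_le_1 abs_le_iff)
  then show False
    using zr assms(2) by blast
qed

text \<open>A principal root with real part zero is purely imaginary, and its square then lies on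
  the branch cut.\<close>

lemma Re_csqrt_pos:
  assumes "w \<notin> \<real>\<^sub>\<le>\<^sub>0"
  shows "Re (csqrt w) > 0"
proof (rule ccontr)
  assume "\<not> Re (csqrt w) > 0"
  then have "Re (csqrt w) = 0"
    using Re_csqrt[of w] by linarith
  then have "csqrt w = \<i> * of_real (Im (csqrt w))"
    by (simp add: complex_eq_iff del: csqrt.sel)
  then have "w = (\<i> * of_real (Im (csqrt w)))\<^sup>2"
    by (metis power2_csqrt)
  then have "w = of_real (- (Im (csqrt w))\<^sup>2)"
    by (simp add: power_mult_distrib del: csqrt.sel)
  then have "w \<in> \<real>\<^sub>\<le>\<^sub>0"
    by (metis neg_le_0_iff_le nonpos_Reals_of_real_iff zero_le_power2)
  with assms show False by simp
qed

lemma Re_divide_eq_mult_cnj: "Re (x / y) = Re (x * cnj y) / (cmod y)\<^sup>2"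
  by (simp add: complex_div_cnj [of x y] Re_divide_of_real flip: of_real_power)

lemma Re_tan_complex: "Re (tan t) = sin (Re t) * cos (Re t) / (cmod (cos t))\<^sup>2" for t :: complex
proof -
  \<comment> \<open>This is cosh^2 - sinh^2 = 1 in exponential form; it removes \<open>Im t\<close>
    from the real part of \<open>sin t * cnj (cos t)\<close>.\<close>
  have "exp (Im t) * exp (- Im t) = 1"
    by (simp flip: exp_add)
  then have "sin (Re t) * cos (Re t) * (exp (Im t) * exp (- Im t)) = sin (Re t) * cos (Re t)"
    by simp
  then have "Re (sin t * cnj (cos t)) = sin (Re t) * cos (Re t)"
    unfolding times_complex.sel cnj.sel Re_sin Im_sin Re_cos Im_cos by (simp add: field_simps)
  then show ?thesis
    by (simp only: tan_def Re_divide_eq_mult_cnj)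
qed

lemma power2_neq_minus_1:
  assumes "Re w > 0"
  shows "w\<^sup>2 \<noteq> -1"
proof
  assume "w\<^sup>2 = -1"
  then have "w = \<i> \<or> w = -\<i>"
    by (metis power2_eq_iff power2_i)
  then show False
    using assms by auto
qed

text \<open>The sign of \<open>Re (tan t)\<close> is that of \<open>sin (Re t) * cos (Re t)\<close>.
  The cosine is positive on the principal strip, so the sine, and with it the angle, is
  positive.\<close>

lemma Re_Arctan_pos:
  assumes "Re w > 0"
  shows "Re (Arctan w) > 0"
proof -
  have "w\<^sup>2 \<noteq> -1"
    using assms by (rule power2_neq_minus_1)
  then have "tan (Arctan w) = w" by simp
  then have "sin (Re (Arctan w)) * cos (Re (Arctan w)) > 0"
    using assms Re_tan_complex[of "Arctan w"]
    by (metis zero_less_divide_iff not_less zero_le_power2)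
  moreover have b: "\<bar>Re (Arctan w)\<bar> < pi / 2"
    using assms by (intro Re_Arctan_bounds) auto
  then have "cos (Re (Arctan w)) > 0"
    by (intro cos_gt_zero_pi) auto
  ultimately have "sin (Re (Arctan w)) > 0"
    by (simp add: zero_less_mult_iff)
  moreover have "sin (- Re (Arctan w)) \<ge> 0" if "Re (Arctan w) \<le> 0"
    using b that by (intro sin_ge_zero) linarith+
  ultimately show ?thesis
    by force
qed

lemma Arctan_inverse_eq_Arcsin_inverse:
  assumes "Re s > 0" "Re z > 0" "s\<^sup>2 = z\<^sup>2 - 1"
  shows "Arctan (1 / s) = Arcsin (1 / z)"
proof -
  define t where "t = Arctan (1 / s)"
  have nz: "s \<noteq> 0" "z \<noteq> 0"
    using assms by auto
  have pos: "Re (1 / s) > 0" "Re (1 / z) > 0"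
    using assms nz by (simp_all add: Re_divide zero_less_divide_iff sum_power2_gt_zero_iff complex_eq_iff)
  have "(1 / s)\<^sup>2 \<noteq> -1"
    using pos(1) by (rule power2_neq_minus_1)
  then have tan: "tan t = 1 / s"
    by (simp add: t_def)
  have t: "Re t > 0" "\<bar>Re t\<bar> < pi / 2"
    using Re_Arctan_pos[OF pos(1)] Re_Arctan_bounds[of "1 / s"] pos by (auto simp: t_def)
  have "cos t = s * sin t"
    using tan nz by (auto simp: tan_def field_simps)
  \<comment> \<open>Since z^2 = s^2 + 1, the left side is the sum of the squares of
    \<open>cos t\<close> and \<open>sin t\<close>.\<close>
  then have "(z * sin t)\<^sup>2 = 1"
    using sin_cos_squared_add[of t] assms(3) by algebra
  then have "z * sin t = 1 \<or> z * sin t = - 1"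
    by (simp only: power2_eq_1_iff)
  then have "sin t = 1 / z \<or> sin t = - (1 / z)"
    using nz by (metis minus_divide_left nonzero_mult_div_cancel_left)
  moreover have "Re (sin t) > 0"
    using t by (intro Re_sin_pos) auto
  ultimately have "sin t = 1 / z"
    using pos by auto
  \<comment> \<open>The bound \<open>\<bar>Re t\<bar> < pi / 2\<close> makes \<open>t\<close> the
    principal value.\<close>
  then show ?thesis
    using Arcsin_unique t unfolding t_def by metis
qed

section \<open>Basic properties of an admissible function\<close>

context
  fixes a :: "real \<Rightarrow> real"
  assumes adm: "admissible a"
begin

lemma admissible_has_derivative: "(a has_real_derivative deriv a x) (at x)"
proof -
  have "((deriv ^^ 0) a) differentiable (at x)"
    using adm unfolding admissible_def smooth_def by blast
  then show ?thesis
    by (simp add: DERIV_deriv_iff_real_differentiable)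
qed

lemma admissible_isCont_deriv: "isCont (deriv a) x"
proof -
  have "((deriv ^^ 1) a) differentiable (at x)"
    using adm unfolding admissible_def smooth_def by blast
  then show ?thesis
    by (simp add: differentiable_imp_continuous_within)
qed

lemma admissible_isCont: "isCont a x"
  using admissible_has_derivative by (rule DERIV_isCont)

lemma admissible_range: "-1 < a x" "a x < 1"
proof -
  have "a x \<in> {-1<..<1}"
    using adm unfolding admissible_def by blast
  then show "-1 < a x" "a x < 1" by auto
qed

lemma admissible_power2_less_1: "(a x)\<^sup>2 < 1"
  using admissible_range[of x] by (simp add: abs_square_less_1)

lemma admissible_mono: "x < y \<Longrightarrow> a x < a y"
  using adm admissible_has_derivative unfolding admissible_def by (meson DERIV_pos_imp_increasing)

lemma admissible_0: "a 0 = 0"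
proof -
  have "a (- 0) = - a 0"
    using adm unfolding admissible_def by blast
  then show ?thesis by simp
qed

lemma admissible_nonneg: "x \<ge> 0 \<Longrightarrow> a x \<ge> 0"
  using admissible_mono[of 0 x] admissible_0 by (cases "x = 0") auto

lemma admissible_tendsto_1: "(a \<longlongrightarrow> 1) at_top"
proof (rule order_tendstoI)
  fix l :: real assume "l < 1"
  \<comment> \<open>The maximum with \<open>0\<close> keeps the level inside the range even when
    \<open>l \<le> -1\<close>.\<close>
  then have "max l 0 \<in> range a"
    using adm unfolding admissible_def by auto
  then obtain x where "a x = max l 0" by auto
  then show "\<forall>\<^sub>F y in at_top. l < a y"
    using admissible_mono[of x] by (auto intro: eventually_mono[OF eventually_gt_at_top[of x]])
next
  fix u :: real assume "1 < u"
  then show "\<forall>\<^sub>F y in at_top. a y < u"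
    using admissible_range(2) by (auto intro!: always_eventually intro: less_trans)
qed

section \<open>The function sqrt (1 - a^2) as an antiderivative, up to a constant factor, of weight
  times \<open>a\<close>\<close>

definition cofactor :: "real \<Rightarrow> real" where
  "cofactor x = sqrt (1 - (a x)\<^sup>2)"

lemma cofactor_pos: "cofactor x > 0"
  using admissible_power2_less_1[of x] by (simp add: cofactor_def)

lemma cofactor_power2: "(cofactor x)\<^sup>2 = 1 - (a x)\<^sup>2"
  using admissible_power2_less_1[of x] by (simp add: cofactor_def)

lemma cofactor_0: "cofactor 0 = 1"
  by (simp add: cofactor_def admissible_0)

lemma cofactor_tendsto_0: "(cofactor \<longlongrightarrow> 0) at_top"
  unfolding cofactor_def[abs_def]
  by (rule tendsto_eq_intros admissible_tendsto_1 refl | simp)+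

lemma cofactor_has_derivative:
  "(cofactor has_real_derivative - pi * (weight a x * a x)) (at x)"
  unfolding cofactor_def[abs_def]
  using admissible_power2_less_1[of x] pi_neq_zero
  by (auto intro!: derivative_eq_intros admissible_has_derivative simp: weight_def field_simps)

lemma cofactor_isCont: "isCont cofactor x"
  using cofactor_has_derivative by (rule DERIV_isCont)

lemma weight_isCont: "isCont (weight a) x"
proof -
  have "weight a = (\<lambda>x. deriv a x / (pi * cofactor x))"
    by (simp add: weight_def cofactor_def fun_eq_iff)
  moreover have "isCont (\<lambda>x. deriv a x / (pi * cofactor x)) x"
    using cofactor_pos[of x] by (intro continuous_intros admissible_isCont_deriv cofactor_isCont) auto
  ultimately show ?thesis by simp
qed

lemma weight_nonneg: "weight a x \<ge> 0"
  using adm admissible_power2_less_1[of x]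
  unfolding weight_def admissible_def by (auto intro!: divide_nonneg_nonneg simp: less_imp_le)

text \<open>A nonnegative function whose antiderivative has finite limits at both ends is
  integrable. It serves as the majorant of the complex integrand.\<close>

lemma weight_mult_integrable: "set_integrable lborel {0<..} (\<lambda>x. weight a x * a x)"
proof -
  have "set_integrable lborel (einterval (ereal 0) \<infinity>) (\<lambda>x. weight a x * a x)"
  proof (rule interval_integral_FTC_nonneg(1))
    show "((\<lambda>x. - (cofactor x / pi)) has_real_derivative weight a x * a x) (at x)" for x
      by (auto intro!: derivative_eq_intros cofactor_has_derivative)
    show "isCont (\<lambda>x. weight a x * a x) x" for x
      by (intro continuous_intros weight_isCont admissible_isCont)
    show "AE x in lborel. ereal 0 < ereal x \<longrightarrow> ereal x < \<infinity> \<longrightarrow> 0 \<le> weight a x * a x"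
      using weight_nonneg admissible_nonneg by auto
    have "isCont (\<lambda>x. - (cofactor x / pi)) 0"
      by (intro continuous_intros cofactor_isCont) simp
    then have "((\<lambda>x. - (cofactor x / pi)) \<longlongrightarrow> - (cofactor 0 / pi)) (at_right 0)"
      unfolding isCont_def by (rule tendsto_within_subset) simp
    then show "(((\<lambda>x. - (cofactor x / pi)) \<circ> real_of_ereal) \<longlongrightarrow> - (cofactor 0 / pi)) (at_right (ereal 0))"
      by (simp only: ereal_tendsto_simps1)
    have "((\<lambda>x. - (cofactor x / pi)) \<longlongrightarrow> - (0 / pi)) at_top"
      by (intro tendsto_intros cofactor_tendsto_0) auto
    then show "(((\<lambda>x. - (cofactor x / pi)) \<circ> real_of_ereal) \<longlongrightarrow> - (0 / pi)) (at_left \<infinity>)"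
      by (simp only: ereal_tendsto_simps1)
  qed simp
  then show ?thesis by simp
qed

section \<open>The integral for a fixed \<open>z\<close>\<close>

context
  fixes z :: complex
  assumes z: "Re z > 0" "z \<notin> complex_of_real ` {-1..1}"
begin

text \<open>Values of \<open>r\<close> in \<open>{0..1}\<close> cover the denominators of the
  integrand and their limit; values of the form \<open>r + 1\<close> with \<open>r \<le> 0\<close>
  keep z^2 - 1 off the cut of \<open>csqrt\<close>.\<close>

lemma denominator_nonzero: "r \<le> 1 \<Longrightarrow> z\<^sup>2 - of_real r \<noteq> 0"
  using power2_neq_of_real[OF z, of r] by simp

lemma I_integrand_denominator_nonzero: "z\<^sup>2 - (complex_of_real (a x))\<^sup>2 \<noteq> 0"
  using denominator_nonzero[of "(a x)\<^sup>2"] admissible_power2_less_1[of x] by simp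

lemma I_integrand_isCont: "isCont (I_integrand a z) x"
  unfolding I_integrand_def[abs_def] using I_integrand_denominator_nonzero[of x]
  by (intro continuous_intros weight_isCont admissible_isCont) auto

text \<open>By compactness the modulus attains its minimum, which is nonzero. The endpoint
  \<open>1\<close> is included because a^2 approaches it at infinity.\<close>

lemma denominator_bounded_below: "\<exists>c>0. \<forall>r\<in>{0..1}. c \<le> cmod (z\<^sup>2 - of_real r)"
proof -
  have "continuous_on {0..1::real} (\<lambda>r. cmod (z\<^sup>2 - of_real r))"
    by (intro continuous_intros)
  then obtain r0 where "r0 \<in> {0..1}" "\<forall>r\<in>{0..1}. cmod (z\<^sup>2 - of_real r0) \<le> cmod (z\<^sup>2 - of_real r)"
    using continuous_attains_inf[of "{0..1::real}" "\<lambda>r. cmod (z\<^sup>2 - of_real r)"] by auto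
  moreover have "cmod (z\<^sup>2 - of_real r0) > 0"
    using denominator_nonzero[of r0] \<open>r0 \<in> {0..1}\<close> by simp
  ultimately show ?thesis by blast
qed

lemma I_integrand_integrable_greaterThan: "set_integrable lborel {0<..} (I_integrand a z)"
proof -
  obtain c where c: "c > 0" "\<And>r. r \<in> {0..1} \<Longrightarrow> c \<le> cmod (z\<^sup>2 - of_real r)"
    using denominator_bounded_below by blast
  have bound: "cmod (I_integrand a z x) \<le> norm (weight a x * a x / c)" if "x > 0" for x
  proof -
    have "c \<le> cmod (z\<^sup>2 - (complex_of_real (a x))\<^sup>2)"
      using c(2)[of "(a x)\<^sup>2"] admissible_power2_less_1[of x] by simp
    then show ?thesis
      using c(1) unfolding I_integrand_def norm_divide
      by (auto intro!: frac_le simp: abs_mult norm_mult)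
  qed
  have "set_integrable lborel {0<..} (\<lambda>x. weight a x * a x / c)"
    using weight_mult_integrable by (rule set_integrable_divide)
  then show ?thesis
  proof (rule set_integrable_bound)
    have "continuous_on UNIV (I_integrand a z)"
      by (simp add: continuous_on_eq_continuous_at I_integrand_isCont)
    then have "I_integrand a z \<in> borel_measurable lborel"
      by (simp add: borel_measurable_continuous_onI)
    then show "set_borel_measurable lborel {0<..} (I_integrand a z)"
      unfolding set_borel_measurable_def by measurable
  qed (use bound in auto)
qed

text \<open>Adding the single point \<open>0\<close> changes nothing, as it is a null set.\<close>

lemma I_integrand_integrable: "set_integrable lborel {0..} (I_integrand a z)"
proof -
  have "integrable lborel (\<lambda>x. indicator {0<..} x *\<^sub>R I_integrand a z x)"
    using I_integrand_integrable_greaterThan by (simp add: set_integrable_def)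
  also have "?this \<longleftrightarrow> integrable lborel (\<lambda>x. indicator {0..} x *\<^sub>R I_integrand a z x)"
    by (rule integrable_discrete_difference[where X = "{0}"]) (auto simp: indicator_def)
  finally show ?thesis
    by (simp add: set_integrable_def)
qed

lemma Re_csqrt_power2_minus_1_pos: "Re (csqrt (z\<^sup>2 - 1)) > 0"
proof (rule Re_csqrt_pos)
  show "z\<^sup>2 - 1 \<notin> \<real>\<^sub>\<le>\<^sub>0"
  proof
    assume "z\<^sup>2 - 1 \<in> \<real>\<^sub>\<le>\<^sub>0"
    then obtain r where "z\<^sup>2 - 1 = of_real r" "r \<le> 0"
      by (auto elim: nonpos_Reals_cases)
    then show False
      using denominator_nonzero[of "r + 1"] by (simp add: algebra_simps)
  qed
qed

lemma I_int_eq: "I_int a z = Arcsin (1 / z) / (complex_of_real pi * csqrt (z\<^sup>2 - 1))"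
proof -
  define s where "s = csqrt (z\<^sup>2 - 1)"
  have s: "Re s > 0" "s\<^sup>2 = z\<^sup>2 - 1"
    using Re_csqrt_power2_minus_1_pos by (simp_all add: s_def del: csqrt.sel)
  then have "s \<noteq> 0" by auto
  define F where "F x = - (Arctan (of_real (cofactor x) / s) / (of_real pi * s))" for x
  \<comment> \<open>This keeps the argument of \<open>Arctan\<close> away from its cuts on the
    imaginary axis.\<close>
  have Re_pos: "Re (of_real u / s) > 0" if "u > 0" for u
    using s(1) that \<open>s \<noteq> 0\<close>
    by (simp add: Re_divide zero_less_divide_iff sum_power2_gt_zero_iff complex_eq_iff)
  have deriv: "(F has_vector_derivative I_integrand a z x) (at x)" for x
  proof -
    let ?u = "complex_of_real (cofactor x)"
    have "((\<lambda>w. - (Arctan (w / s) / (of_real pi * s))) has_field_derivative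
            - (inverse (1 + (?u / s)\<^sup>2) * (1 / s) / (of_real pi * s))) (at ?u)"
      using Re_pos[OF cofactor_pos, of x]
      by (auto intro!: derivative_eq_intros has_field_derivative_Arctan[THEN DERIV_chain2])
    moreover have "((\<lambda>x. complex_of_real (cofactor x)) has_vector_derivative
            of_real (- pi * (weight a x * a x))) (at x)"
      using cofactor_has_derivative[of x]
      by (intro has_vector_derivative_of_real) 
        (simp add: has_real_derivative_iff_has_vector_derivative)
    \<comment> \<open>Chain rule for a complex differentiable function along the real curve
      \<open>cofactor\<close>.\<close>
    ultimately have "(F has_vector_derivative of_real (- pi * (weight a x * a x)) *
        - (inverse (1 + (?u / s)\<^sup>2) * (1 / s) / (of_real pi * s))) (at x)"
      unfolding F_def[abs_def] by (rule field_vector_diff_chain_at[unfolded o_def, rotated])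
    moreover have "of_real (- pi * (weight a x * a x)) *
        - (inverse (1 + (?u / s)\<^sup>2) * (1 / s) / (of_real pi * s)) = I_integrand a z x"
    proof -
      have "?u\<^sup>2 = 1 - (complex_of_real (a x))\<^sup>2"
        using arg_cong[OF cofactor_power2[of x], of complex_of_real] by simp
      then have D: "z\<^sup>2 - (complex_of_real (a x))\<^sup>2 = s\<^sup>2 + ?u\<^sup>2"
        using s(2) by simp
      then have "s\<^sup>2 + ?u\<^sup>2 \<noteq> 0"
        using I_integrand_denominator_nonzero[of x] by simp
      moreover have "inverse (1 + (?u / s)\<^sup>2) = s\<^sup>2 / (s\<^sup>2 + ?u\<^sup>2)"
        using \<open>s \<noteq> 0\<close> by (simp add: field_simps)
      ultimately show ?thesis
        unfolding I_integrand_def D using \<open>s \<noteq> 0\<close>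
        by (simp add: power2_eq_square[of s] del: of_real_power)
    qed
    ultimately show ?thesis by simp
  qed
  have "(LBINT x=ereal 0..\<infinity>. I_integrand a z x) = 0 - F 0"
  proof (rule interval_integral_FTC_integrable)
    show "set_integrable lborel (einterval (ereal 0) \<infinity>) (I_integrand a z)"
      using I_integrand_integrable_greaterThan by simp
    have "isCont F 0"
      using deriv by (rule has_vector_derivative_continuous)
    then have "(F \<longlongrightarrow> F 0) (at_right 0)"
      unfolding isCont_def by (rule tendsto_within_subset) simp
    then show "((F \<circ> real_of_ereal) \<longlongrightarrow> F 0) (at_right (ereal 0))"
      by (simp only: ereal_tendsto_simps1)
    have "((\<lambda>x. of_real (cofactor x) / s) \<longlongrightarrow> of_real 0 / s) at_top"
      using \<open>s \<noteq> 0\<close> by (intro tendsto_intros cofactor_tendsto_0)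
    \<comment> \<open>The limit point \<open>0\<close> is on the imaginary axis but between the two
      cuts, so \<open>Arctan\<close> is continuous there.\<close>
    then have "((\<lambda>x. Arctan (of_real (cofactor x) / s)) \<longlongrightarrow> Arctan 0) at_top"
      by (intro isCont_tendsto_compose[OF continuous_at_Arctan]) auto
    then have "(F \<longlongrightarrow> - (Arctan 0 / (of_real pi * s))) at_top"
      unfolding F_def[abs_def] using \<open>s \<noteq> 0\<close> by (intro tendsto_intros) auto
    then have "(F \<longlongrightarrow> 0) at_top"
      by simp
    then show "((F \<circ> real_of_ereal) \<longlongrightarrow> 0) (at_left \<infinity>)"
      by (simp only: ereal_tendsto_simps1)
  qed (use deriv I_integrand_isCont in auto)
  then have "(LINT x:{0<..}|lborel. I_integrand a z x) = Arctan (1 / s) / (of_real pi * s)"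
    by (simp add: interval_integral_to_infinity_eq F_def cofactor_0)
  moreover have "I_int a z = (LINT x:{0<..}|lborel. I_integrand a z x)"
    unfolding I_int_def
    by (rule set_integral_discrete_difference[where X = "{0}"]) auto
  moreover have "Arctan (1 / s) = Arcsin (1 / z)"
    using s(1) z(1) s(2) by (rule Arctan_inverse_eq_Arcsin_inverse)
  ultimately show ?thesis
    by (simp add: s_def)
qed

end

end

text \<open>Integrability ensures that the integral is not merely the default value
  \<open>0\<close>. Independence holds because the closed form does not involve
  \<open>a\<close>.\<close>

theorem mainTheorem12:
  fixes a :: "real \<Rightarrow> real" and z :: complex
  assumes "admissible a"
    and "Re z > 0"
    and "z \<notin> complex_of_real ` {-1..1}"
  shows "set_integrable lborel {0..} (I_integrand a z)
    \<and> I_int a z = Arcsin (1 / z) / (complex_of_real pi * csqrt (z\<^sup>2 - 1))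
    \<and> (\<forall>b. admissible b \<longrightarrow> I_int b z = I_int a z)"
  using assms I_integrand_integrable I_int_eq by simp

end
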